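(* Let $(X,E)$ be an undirected simple graph with finite vertex set $X$ which is transitive, let $Y$ be a finite set and let $F:X\to 2^Y$ be a set-valued mapping. The following statements are equivalent: (i) $F$ admits a Hall collection. (ii) $F$ admits a disparate selection.
   Context: $\sharp$ denotes cardinality; $\subset$ allows equality. Empty images $F(x)$ are allowed. $(X,E)$ is called transitive if $\{x,x'\}\in E$, $\{x',x''\}\in E$ and $x\ne x''$ imply $\{x,x''\}\in E$. $G(F)=\{(x,y)\in X\times Y\mid y\in F(x)\}$, and $F_{|V}$ is the restriction of $F$ to $V\subset X$. A selection of $F$ is a map $s:X\to Y$ with $s(x)\in F(x)$ for all $x\in X$. Points $(x,y),(x',y')\in X\times Y$ are disparate if $(x,y)\ne(x',y')$ and ($y=y'$ implies $\{x,x'\}\notin E$). A set $A\subset X\times Y$ is disparate if any two distinct points of $A$ are disparate. A selection $s$ is disparate if $\{(x,s(x))\mid x\in X\}$ is a disparate set. A Hall collection of $F$ is a family $(A_V)$ indexed by the nonempty sets $V\subset X$ such that $A_V\subset G(F_{|V})$, $A_V$ is a disparate set and $\sharp A_V\ge\sharp V$ for each nonempty $V\subset X$. *)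

theory Defs
  imports "HOL-Library.FuncSet"
begin

definition simple_graph :: "'a set \<Rightarrow> 'a set set \<Rightarrow> bool" where
  "simple_graph X E \<longleftrightarrow> (\<forall>e\<in>E. e \<subseteq> X \<and> card e = 2)"

definition transitive_graph :: "'a set \<Rightarrow> 'a set set \<Rightarrow> bool" where
  "transitive_graph X E \<longleftrightarrow>
     (\<forall>x\<in>X. \<forall>x'\<in>X. \<forall>x''\<in>X.
        {x, x'} \<in> E \<longrightarrow> {x', x''} \<in> E \<longrightarrow> x \<noteq> x'' \<longrightarrow> {x, x''} \<in> E)"

definition disparate_points :: "'a set set \<Rightarrow> 'a \<times> 'b \<Rightarrow> 'a \<times> 'b \<Rightarrow> bool" where
  "disparate_points E p q \<longleftrightarrow> p \<noteq> q \<and> (snd p = snd q \<longrightarrow> {fst p, fst q} \<notin> E)"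

definition disparate_set :: "'a set set \<Rightarrow> ('a \<times> 'b) set \<Rightarrow> bool" where
  "disparate_set E A \<longleftrightarrow> (\<forall>p\<in>A. \<forall>q\<in>A. p \<noteq> q \<longrightarrow> disparate_points E p q)"

text \<open>The graph of the restriction of a set-valued mapping \<open>F\<close> to \<open>V\<close>, that is, the set of
  all \<open>(x, y)\<close> with \<open>x \<in> V\<close> and \<open>y \<in> F x\<close>, is the dependent sum \<open>Sigma V F\<close>.\<close>

definition Hall_collection ::
    "'a set \<Rightarrow> 'a set set \<Rightarrow> ('a \<Rightarrow> 'b set) \<Rightarrow> ('a set \<Rightarrow> ('a \<times> 'b) set) \<Rightarrow> bool" where
  "Hall_collection X E F A \<longleftrightarrow>
     (\<forall>V. V \<subseteq> X \<and> V \<noteq> {} \<longrightarrow>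
        A V \<subseteq> Sigma V F \<and> disparate_set E (A V) \<and> card V \<le> card (A V))"

definition selection :: "'a set \<Rightarrow> 'b set \<Rightarrow> ('a \<Rightarrow> 'b set) \<Rightarrow> ('a \<Rightarrow> 'b) \<Rightarrow> bool" where
  "selection X Y F s \<longleftrightarrow> s \<in> X \<rightarrow> Y \<and> (\<forall>x\<in>X. s x \<in> F x)"

definition disparate_selection ::
    "'a set \<Rightarrow> 'a set set \<Rightarrow> 'b set \<Rightarrow> ('a \<Rightarrow> 'b set) \<Rightarrow> ('a \<Rightarrow> 'b) \<Rightarrow> bool" where
  "disparate_selection X E Y F s \<longleftrightarrow>
     selection X Y F s \<and> disparate_set E ((\<lambda>x. (x, s x)) ` X)"

end

theory Submission
  imports Defs
begin

text \<open>A transitive graph is a disjoint union of cliques, so distinct vertices are adjacent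
  exactly when they lie in the same component. Tag every value \<open>y \<in> F x\<close> with the component of
  \<open>x\<close>. A subset of the graph of \<open>F\<close> is disparate if and only if no two of its distinct
  points carry the same tagged value (\<open>disparate_set_iff\<close>). Consequently a disparate selection
  of \<open>F\<close> is the same thing as an injective selection of the tagged mapping, and a disparate set
  in the graph of the restriction of \<open>F\<close> to \<open>V\<close> injects into the set of tagged values over \<open>V\<close>.
  A Hall collection therefore yields Hall's condition for the tagged mapping, and Hall's
  marriage theorem (\<open>Hall_marriage\<close>, proved by the argument of Halmos and Vaughan) provides the
  injective selection. Conversely, the graphs of the restrictions of a disparate selection form
  a Hall collection.\<close>

theorem Hall_marriage:
  assumes "finite X" and "\<And>x. x \<in> X \<Longrightarrow> finite (F x)"
    and "\<And>V. V \<subseteq> X \<Longrightarrow> card V \<le> card (\<Union> (F ` V))"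
  shows "\<exists>s. (\<forall>x\<in>X. s x \<in> F x) \<and> inj_on s X"
  using assms
proof (induction X arbitrary: F rule: finite_psubset_induct)
  case (psubset X)
  note hall = psubset.prems(2)
  have fin: "finite (\<Union> (F ` V))" if "V \<subseteq> X" for V
    using that psubset.prems(1) finite_subset[OF that psubset.hyps] by auto
  show ?case
  proof (cases "\<exists>V. V \<subset> X \<and> V \<noteq> {} \<and> card (\<Union> (F ` V)) = card V")
    \<comment> \<open>A critical set \<open>V\<close> uses up all its values; the other points must avoid them.\<close>
    case True
    then obtain V where V: "V \<subset> X" "V \<noteq> {}" and crit: "card (\<Union> (F ` V)) = card V"
      by blast
    define G where "G x = F x - \<Union> (F ` V)" for x
    have "\<exists>s. (\<forall>x\<in>V. s x \<in> F x) \<and> inj_on s V"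
      using V psubset.prems by (intro psubset.IH) auto
    then obtain s where s: "\<forall>x\<in>V. s x \<in> F x" "inj_on s V"
      by blast
    have "\<exists>t. (\<forall>x\<in>X - V. t x \<in> G x) \<and> inj_on t (X - V)"
    proof (rule psubset.IH)
      show "X - V \<subset> X"
        using V by blast
      show "finite (G x)" if "x \<in> X - V" for x
        using that psubset.prems(1) by (simp add: G_def)
      show "card W \<le> card (\<Union> (G ` W))" if W: "W \<subseteq> X - V" for W
      proof -
        have sub: "W \<subseteq> X" "V \<subseteq> X" "W \<union> V \<subseteq> X"
          using W V by auto
        have "card W + card V = card (W \<union> V)"
          using W sub psubset.hyps by (subst card_Un_disjoint) (auto intro: finite_subset)
        also have "\<dots> \<le> card (\<Union> (F ` (W \<union> V)))"
          using sub by (intro hall)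
        also have "\<Union> (F ` (W \<union> V)) = \<Union> (G ` W) \<union> \<Union> (F ` V)"
          by (auto simp: G_def)
        also have "card \<dots> \<le> card (\<Union> (G ` W)) + card V"
          by (metis card_Un_le crit)
        finally show ?thesis
          by simp
      qed
    qed
    then obtain t where t: "\<forall>x\<in>X - V. t x \<in> G x" "inj_on t (X - V)"
      by blast
    have "inj_on (\<lambda>x. if x \<in> V then s x else t x) X"
    proof (rule inj_onI)
      fix x x'
      assume "x \<in> X" "x' \<in> X"
        and "(if x \<in> V then s x else t x) = (if x' \<in> V then s x' else t x')"
      moreover have "s z \<noteq> t z'" if "z \<in> V" "z' \<in> X - V" for z z'
        using s(1) t(1) that by (fastforce simp: G_def)
      ultimately show "x = x'"
        using inj_onD[OF s(2)] inj_onD[OF t(2)] by (cases "x \<in> V"; cases "x' \<in> V") (force+)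
    qed
    moreover have "\<forall>x\<in>X. (if x \<in> V then s x else t x) \<in> F x"
      using s(1) t(1) by (auto simp: G_def)
    ultimately show ?thesis
      by (intro exI[of _ "\<lambda>x. if x \<in> V then s x else t x"] conjI)
  next
    \<comment> \<open>Without critical sets, Hall's condition is strict on nonempty proper subsets, so that
      it survives the loss of one value: any \<open>y \<in> F x\<close> may be assigned to any one \<open>x\<close>.\<close>
    case False
    show ?thesis
    proof (cases "X = {}")
      case nonempty: False
      then obtain x where x: "x \<in> X"
        by blast
      have "F x \<noteq> {}"
        using hall[of "{x}"] x by auto
      then obtain y where y: "y \<in> F x"
        by blast
      have "\<exists>t. (\<forall>z\<in>X - {x}. t z \<in> F z - {y}) \<and> inj_on t (X - {x})"
      proof (rule psubset.IH)
        show "X - {x} \<subset> X"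
          using x by blast
        show "finite (F z - {y})" if "z \<in> X - {x}" for z
          using that psubset.prems(1) by simp
        show "card W \<le> card (\<Union>z\<in>W. F z - {y})" if W: "W \<subseteq> X - {x}" for W
        proof (cases "W = {}")
          case W_ne: False
          have WX: "W \<subset> X"
            using W x by blast
          have "card W \<noteq> card (\<Union> (F ` W))"
            using False W_ne WX by metis
          with hall[of W] WX have "card W < card (\<Union> (F ` W))"
            by (simp add: psubset_imp_subset le_neq_implies_less)
          then have "card W \<le> card (\<Union> (F ` W) - {y})"
            by (auto simp: card_Diff_singleton_if)
          moreover have "(\<Union>z\<in>W. F z - {y}) = \<Union> (F ` W) - {y}"
            by blast
          ultimately show ?thesis
            by simp
        qed simp
      qed
      then obtain t where t: "\<forall>z\<in>X - {x}. t z \<in> F z - {y}" "inj_on t (X - {x})"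
        by blast
      have "inj_on (t(x := y)) (insert x (X - {x}))"
        unfolding inj_on_insert using t by (auto simp: inj_on_def)
      then have "inj_on (t(x := y)) X"
        using x by (simp add: insert_absorb)
      moreover have "\<forall>z\<in>X. (t(x := y)) z \<in> F z"
        using t(1) y by auto
      ultimately show ?thesis
        by blast
    qed simp
  qed
qed

text \<open>The component of \<open>x\<close> in a transitive graph: \<open>x\<close> together with its neighbours. In a
  general graph this is only the closed neighbourhood of \<open>x\<close>.\<close>

definition clique_of :: "'a set set \<Rightarrow> 'a \<Rightarrow> 'a set" where
  "clique_of E x = insert x {z. {x, z} \<in> E}"

lemma clique_of_eq_iff:
  assumes "simple_graph X E" and "transitive_graph X E" and "x \<in> X" and "x' \<in> X"
  shows "clique_of E x = clique_of E x' \<longleftrightarrow> x = x' \<or> {x, x'} \<in> E"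
proof
  assume "clique_of E x = clique_of E x'"
  then have "x' \<in> clique_of E x"
    by (simp add: clique_of_def)
  then show "x = x' \<or> {x, x'} \<in> E"
    by (auto simp: clique_of_def)
next
  have sub: "clique_of E u \<subseteq> clique_of E v" if "u \<in> X" "v \<in> X" "{v, u} \<in> E" for u v
  proof
    fix z
    assume z: "z \<in> clique_of E u"
    have "z \<in> X"
      using z that(1) assms(1) by (auto simp: clique_of_def simple_graph_def)
    then show "z \<in> clique_of E v"
      using z that assms(2) unfolding clique_of_def transitive_graph_def by blast
  qed
  assume "x = x' \<or> {x, x'} \<in> E"
  then show "clique_of E x = clique_of E x'"
    using sub[of x x'] sub[of x' x] assms(3,4) by (auto simp: insert_commute)
qed

lemma disparate_set_iff:
  assumes "simple_graph X E" and "transitive_graph X E" and "A \<subseteq> X \<times> UNIV"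
  shows "disparate_set E A \<longleftrightarrow> inj_on (\<lambda>(x, y). (clique_of E x, y)) A"
proof -
  have "disparate_points E p q \<longleftrightarrow> (clique_of E (fst p), snd p) \<noteq> (clique_of E (fst q), snd q)"
    if "p \<in> A" "q \<in> A" "p \<noteq> q" for p q
  proof -
    have "fst p \<in> X" "fst q \<in> X"
      using that assms(3) by auto
    then show ?thesis
      using clique_of_eq_iff[OF assms(1,2)] that(3)
      by (auto simp: disparate_points_def prod_eq_iff)
  qed
  then show ?thesis
    unfolding disparate_set_def inj_on_def case_prod_beta by metis
qed

theorem theorem12p14:
  fixes X :: "'a set" and E :: "'a set set" and Y :: "'b set" and F :: "'a \<Rightarrow> 'b set"
  assumes "finite X"
    and "simple_graph X E"
    and "transitive_graph X E"
    and "finite Y"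
    and "F \<in> X \<rightarrow> Pow Y"
  shows "(\<exists>A. Hall_collection X E F A) \<longleftrightarrow> (\<exists>s. disparate_selection X E Y F s)"
proof
  let ?tag = "\<lambda>(x, y). (clique_of E x, y)"
  assume "\<exists>A. Hall_collection X E F A"
  then obtain A where A: "Hall_collection X E F A" ..
  define G where "G x = Pair (clique_of E x) ` F x" for x
  have finF: "finite (F x)" if "x \<in> X" for x
    using that assms(4,5) by (auto intro: finite_subset)
  have "\<exists>t. (\<forall>x\<in>X. t x \<in> G x) \<and> inj_on t X"
  proof (rule Hall_marriage)
    show "finite (G x)" if "x \<in> X" for x
      using finF[OF that] by (simp add: G_def)
    show "card V \<le> card (\<Union> (G ` V))" if V: "V \<subseteq> X" for V
    proof (cases "V = {}")
      case False
      then have AV: "A V \<subseteq> Sigma V F" "disparate_set E (A V)" "card V \<le> card (A V)"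
        using A V by (auto simp: Hall_collection_def)
      have "A V \<subseteq> X \<times> UNIV"
        using AV(1) V by auto
      then have "inj_on ?tag (A V)"
        using AV(2) disparate_set_iff[OF assms(2,3)] by blast
      moreover have "?tag ` A V \<subseteq> \<Union> (G ` V)"
        using AV(1) by (auto simp: G_def)
      moreover have "finite (\<Union> (G ` V))"
        using V finF finite_subset[OF V assms(1)] by (auto simp: G_def)
      ultimately have "card (A V) \<le> card (\<Union> (G ` V))"
        by (rule card_inj_on_le)
      with AV(3) show ?thesis
        by simp
    qed simp
  qed (fact assms(1))
  then obtain t where t: "\<forall>x\<in>X. t x \<in> G x" "inj_on t X"
    by blast
  define s where "s x = snd (t x)" for x
  have ts: "t x = (clique_of E x, s x)" and sF: "s x \<in> F x" if "x \<in> X" for x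
    using t(1) that by (auto simp: G_def s_def)
  have "inj_on ?tag ((\<lambda>x. (x, s x)) ` X)"
    using t(2) ts by (auto simp: inj_on_def)
  then have "disparate_set E ((\<lambda>x. (x, s x)) ` X)"
    by (subst disparate_set_iff[OF assms(2,3)]) auto
  moreover have "selection X Y F s"
    using sF assms(5) by (auto simp: selection_def)
  ultimately show "\<exists>s. disparate_selection X E Y F s"
    by (auto simp: disparate_selection_def)
next
  assume "\<exists>s. disparate_selection X E Y F s"
  then obtain s where s: "\<forall>x\<in>X. s x \<in> F x" "disparate_set E ((\<lambda>x. (x, s x)) ` X)"
    by (auto simp: disparate_selection_def selection_def)
  have "Hall_collection X E F (\<lambda>V. (\<lambda>x. (x, s x)) ` V)"
    unfolding Hall_collection_def
  proof (intro allI impI conjI)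
    fix V
    assume V: "V \<subseteq> X \<and> V \<noteq> {}"
    show "(\<lambda>x. (x, s x)) ` V \<subseteq> Sigma V F"
      using s(1) V by auto
    show "disparate_set E ((\<lambda>x. (x, s x)) ` V)"
      using s(2) V unfolding disparate_set_def by blast
    show "card V \<le> card ((\<lambda>x. (x, s x)) ` V)"
      by (simp add: card_image inj_on_def)
  qed
  then show "\<exists>A. Hall_collection X E F A"
    by blast
qed

end
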